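(* Let $d \in \{2,3\}$ and let $\psi \colon \mathbb{R}^{d} \to \mathbb{R}_\infty$ be a convex and lower semicontinuous function satisfying $$\psi(e(\nu)) = \psi(e(\operatorname{diag}(\epsilon)\nu)) \quad\text{for all } \nu\in\mathbb{R}^d \text{ and all } \epsilon\in\{-1,1\}^d \text{ with } \prod_{i=1}^d\epsilon_i=1$$ and $\psi(\alpha_1,\dots,\alpha_d)=\infty$ whenever $\alpha_d\le 0$. Let $W\colon\mathbb{R}^{d\times d}\to\mathbb{R}_\infty$ be given by $$W(F)=\begin{cases}\psi(I(U)) & \text{if } \det(F)>0,\\ \infty & \text{if } \det(F)\le 0,\end{cases}$$ where $U$ is the symmetric positive definite right stretch tensor of $F$, i.e. $U^2=F^\top F$, and $I(U)$ denotes the vector of its principal invariants. Then $W$ is isotropic and lower semicontinuous polyconvex.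
   Context: $\mathbb{R}_\infty := \mathbb{R}\cup\{\infty\}$. $\operatorname{diag}(\epsilon)$ is the diagonal matrix with entries $\epsilon_1,\dots,\epsilon_d$. The map $e\colon\mathbb{R}^d\to\mathbb{R}^d$ is $e(x)=(x_1+x_2,\;x_1x_2)$ for $d=2$ and $e(x)=(x_1+x_2+x_3,\;x_2x_3+x_1x_3+x_1x_2,\;x_1x_2x_3)$ for $d=3$. The principal invariants are $I(U)=(\operatorname{tr}U,\det U)$ for $d=2$ and $I(U)=(\operatorname{tr}(U),\operatorname{tr}(\operatorname{adj}(U)),\det(U))$ for $d=3$, where $\operatorname{adj}$ is the adjugate matrix. $W$ is isotropic if $W(F)=W(R_1FR_2)$ for all $F\in\mathbb{R}^{d\times d}$, $R_1,R_2\in\mathrm{SO}(d)$. $W$ is lower semicontinuous polyconvex if there is a lower semicontinuous convex $G\colon\mathbb{R}^{K_d}\to\mathbb{R}_\infty$ with $W(F)=G(\mathcal{M}(F))$ for all $F\in\mathbb{R}^{d\times d}$, where $\mathcal{M}(F)$ is the vector of all minors of $F$: $\mathcal{M}(F)=(F,\det F)\in\mathbb{R}^5$ ($K_2=5$) for $d=2$, and $\mathcal{M}(F)=(F,\operatorname{adj}(F)^\top,\det F)\in\mathbb{R}^{19}$ ($K_3=19$) for $d=3$. *)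

theory Defs
  imports "HOL-Analysis.Analysis"
begin

text \<open>
  A function into \<open>\<real> \<union> {\<infinity>}\<close> is an \<^typ>\<open>ereal\<close>-valued function that never takes the value
  \<open>-\<infinity>\<close>; with this restriction no \<open>\<infinity> - \<infinity>\<close> arises in the convexity inequality below, and the
  convention \<open>0 * \<infinity> = 0\<close> of \<^typ>\<open>ereal\<close> makes its endpoint cases trivial.
\<close>

definition real_or_infty :: "('a \<Rightarrow> ereal) \<Rightarrow> bool" where
  "real_or_infty f \<longleftrightarrow> (\<forall>x. f x \<noteq> -\<infinity>)"

definition convex_fun :: "('a::real_vector \<Rightarrow> ereal) \<Rightarrow> bool" where
  "convex_fun f \<longleftrightarrow>
     (\<forall>x y. \<forall>u\<ge>0. \<forall>v\<ge>0. u + v = 1 \<longrightarrow>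
        f (u *\<^sub>R x + v *\<^sub>R y) \<le> ereal u * f x + ereal v * f y)"

definition lsc_fun :: "('a::topological_space \<Rightarrow> ereal) \<Rightarrow> bool" where
  "lsc_fun f \<longleftrightarrow> (\<forall>x. f x \<le> Liminf (at x) f)"

definition diag :: "real^'n \<Rightarrow> real^'n^'n" where
  "diag \<epsilon> = (\<chi> i j. if i = j then \<epsilon> $ i else 0)"

definition e2 :: "real^2 \<Rightarrow> real^2" where
  "e2 x = vector [x$1 + x$2, x$1 * x$2]"

definition e3 :: "real^3 \<Rightarrow> real^3" where
  "e3 x = vector [x$1 + x$2 + x$3, x$2 * x$3 + x$1 * x$3 + x$1 * x$2, x$1 * x$2 * x$3]"

definition adj3 :: "real^3^3 \<Rightarrow> real^3^3" where
  "adj3 A = vector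
     [vector [A$2$2 * A$3$3 - A$2$3 * A$3$2, A$1$3 * A$3$2 - A$1$2 * A$3$3, A$1$2 * A$2$3 - A$1$3 * A$2$2],
      vector [A$2$3 * A$3$1 - A$2$1 * A$3$3, A$1$1 * A$3$3 - A$1$3 * A$3$1, A$1$3 * A$2$1 - A$1$1 * A$2$3],
      vector [A$2$1 * A$3$2 - A$2$2 * A$3$1, A$1$2 * A$3$1 - A$1$1 * A$3$2, A$1$1 * A$2$2 - A$1$2 * A$2$1]]"

lemma mult_adj3: "A ** adj3 A = mat (det A)"
  by (simp add: adj3_def vec_eq_iff forall_3 matrix_matrix_mult_def mat_def det_3 sum_3
      algebra_simps)

definition inv2 :: "real^2^2 \<Rightarrow> real^2" where
  "inv2 U = vector [trace U, det U]"

definition inv3 :: "real^3^3 \<Rightarrow> real^3" where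
  "inv3 U = vector [trace U, trace (adj3 U), det U]"

definition sym_pos_def :: "real^'n^'n \<Rightarrow> bool" where
  "sym_pos_def U \<longleftrightarrow> transpose U = U \<and> (\<forall>x. x \<noteq> 0 \<longrightarrow> x \<bullet> (U *v x) > 0)"

definition right_stretch :: "real^'n^'n \<Rightarrow> real^'n^'n" where
  "right_stretch F = (THE U. sym_pos_def U \<and> U ** U = transpose F ** F)"

definition isotropic :: "(real^'n^'n \<Rightarrow> ereal) \<Rightarrow> bool" where
  "isotropic W \<longleftrightarrow>
     (\<forall>F R1 R2. rotation_matrix R1 \<and> rotation_matrix R2 \<longrightarrow> W F = W (R1 ** F ** R2))"

text \<open>
  The spaces of minors \<open>\<real>\<^sup>5\<close> and \<open>\<real>\<^sup>1\<^sup>9\<close> are represented by the product spaces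
  \<open>\<real>\<^sup>2\<^sup>\<times>\<^sup>2 \<times> \<real>\<close> and \<open>\<real>\<^sup>3\<^sup>\<times>\<^sup>3 \<times> \<real>\<^sup>3\<^sup>\<times>\<^sup>3 \<times> \<real>\<close>.
\<close>

definition minors2 :: "real^2^2 \<Rightarrow> (real^2^2) \<times> real" where
  "minors2 F = (F, det F)"

definition minors3 :: "real^3^3 \<Rightarrow> (real^3^3) \<times> (real^3^3) \<times> real" where
  "minors3 F = (F, transpose (adj3 F), det F)"

definition lsc_polyconvex2 :: "(real^2^2 \<Rightarrow> ereal) \<Rightarrow> bool" where
  "lsc_polyconvex2 W \<longleftrightarrow>
     (\<exists>G. real_or_infty G \<and> lsc_fun G \<and> convex_fun G \<and> (\<forall>F. W F = G (minors2 F)))"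

definition lsc_polyconvex3 :: "(real^3^3 \<Rightarrow> ereal) \<Rightarrow> bool" where
  "lsc_polyconvex3 W \<longleftrightarrow>
     (\<exists>G. real_or_infty G \<and> lsc_fun G \<and> convex_fun G \<and> (\<forall>F. W F = G (minors3 F)))"

end

theory Submission
  imports Defs
begin

text \<open>
  For a rotation \<open>R\<close> the principal invariants of \<open>R F\<close> depend linearly on the minors of \<open>F\<close>:
  for \<open>d = 3\<close> they are \<open>(tr (R F), tr (R cof F), det F)\<close>. Hence the supremum over all rotations
  \<open>R\<close> of \<open>\<psi>\<close> at these values, with \<open>(F, cof F, det F)\<close> replaced by independent variables, is a convex
  lower semicontinuous function \<open>G\<close> of the minors. It agrees with \<open>W\<close> for the following reason. If
  \<open>F = Q U\<close> and \<open>U = P diag(\<nu>) P\<^sup>T\<close>, the invariants of \<open>R F\<close> are those of \<open>S diag(\<nu>)\<close> with the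
  rotation \<open>S = P\<^sup>T R Q P\<close>, and they involve only the diagonal of \<open>S\<close>. That diagonal is a convex
  combination of sign vectors \<open>\<epsilon>\<close> with product 1 (Horn), so the invariants are the same convex
  combination of the points \<open>e(diag(\<epsilon>) \<nu>)\<close>, on all of which \<open>\<psi>\<close> has the value \<open>\<psi>(e(\<nu>)) = \<psi>(I(U))\<close>.
  The choice \<open>R = Q\<^sup>T\<close> attains the supremum.
\<close>

subsection \<open>Diagonalization of symmetric matrices\<close>

lemma diag_mult_vector: "(diag v *v x) $ i = v $ i * x $ i"
  by (simp add: diag_def matrix_vector_mult_def if_distrib[of "\<lambda>a. a * _"] cong: if_cong)

lemma diag_mult_diag: "diag v ** diag w = diag (\<chi> i. v $ i * w $ i)"
  by (simp add: diag_def matrix_matrix_mult_def vec_eq_iff if_distrib[of "\<lambda>a. a * _"] cong: if_cong)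

lemma transpose_diag: "transpose (diag v) = diag v"
  by (simp add: diag_def transpose_def vec_eq_iff)

lemma symmetric_matrix_inner:
  fixes A :: "real^'n^'n"
  assumes "transpose A = A"
  shows "(A *v x) \<bullet> y = x \<bullet> (A *v y)"
  using dot_lmul_matrix[of x A y] assms
  by (metis transpose_matrix_vector)

text \<open>The quadratic form attains its maximum on the compact unit sphere of \<open>S\<close>,
  and the maximizer \<open>v\<close> is an eigenvector: invariance keeps the residual
  \<open>w\<close> inside \<open>S\<close>, and a nonzero residual would be a direction of increase
  of the Rayleigh quotient.\<close>

lemma symmetric_eigenvector_in_subspace:
  fixes A :: "real^'n^'n"
  assumes A: "transpose A = A" and S: "subspace S" and inv: "\<And>x. x \<in> S \<Longrightarrow> A *v x \<in> S"
    and nz: "z \<in> S" "z \<noteq> 0"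
  obtains v c where "v \<in> S" "norm v = 1" "A *v v = c *\<^sub>R v"
proof -
  have "compact (S \<inter> sphere 0 1)"
    by (intro closed_Int_compact closed_subspace S compact_sphere)
  moreover have "(1 / norm z) *\<^sub>R z \<in> S \<inter> sphere 0 1"
    using nz S by (simp add: subspace_scale)
  ultimately have "compact (S \<inter> sphere 0 1)" "S \<inter> sphere 0 1 \<noteq> {}" by blast+
  moreover have "continuous_on (S \<inter> sphere 0 1) (\<lambda>x. x \<bullet> (A *v x))"
    by (intro continuous_intros matrix_vector_mult_linear_continuous_on)
  ultimately obtain v where v_in: "v \<in> S \<inter> sphere 0 1"
    and v_max: "\<forall>y \<in> S \<inter> sphere 0 1. y \<bullet> (A *v y) \<le> v \<bullet> (A *v v)"
    using continuous_attains_sup[of "S \<inter> sphere 0 1" "\<lambda>x. x \<bullet> (A *v x)"] by blast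
  then have v: "v \<in> S" "norm v = 1"
    and max: "\<And>y. y \<in> S \<Longrightarrow> norm y = 1 \<Longrightarrow> y \<bullet> (A *v y) \<le> v \<bullet> (A *v v)"
    by auto
  define c where "c = v \<bullet> (A *v v)"
  define w where "w = A *v v - c *\<^sub>R v"
  have w: "w \<in> S" using S v inv by (auto simp: w_def intro: subspace_diff subspace_scale)
  have vv: "v \<bullet> v = 1" using v by (simp add: dot_square_norm)
  \<comment> \<open>Homogeneity of degree two carries maximality from the unit sphere to all of
    \<open>S\<close>.\<close>
  have bound: "y \<bullet> (A *v y) \<le> c * (y \<bullet> y)" if y: "y \<in> S" for y
  proof (cases "y = 0")
    case False
    have "((1 / norm y) *\<^sub>R y) \<bullet> (A *v ((1 / norm y) *\<^sub>R y)) \<le> c"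
      unfolding c_def using False y S by (intro max) (auto intro: subspace_scale)
    then show ?thesis
      using False by (simp add: matrix_vector_mult_scaleR dot_square_norm field_simps power2_eq_square)
  qed simp
  \<comment> \<open>This is \<open>bound\<close> on the line through \<open>v\<close> in direction
    \<open>w\<close>: the constant terms cancel, and the linear coefficient is
    \<open>2 * (w \<bullet> w)\<close>.\<close>
  have quad: "2 * t * (w \<bullet> w) + t\<^sup>2 * (w \<bullet> (A *v w) - c * (w \<bullet> w)) \<le> 0" for t
  proof -
    have 1: "v \<bullet> (A *v w) = w \<bullet> w + c * (w \<bullet> v)"
      unfolding symmetric_matrix_inner[OF A, symmetric]
      by (simp add: w_def inner_simps inner_commute algebra_simps)
    have 2: "w \<bullet> (A *v v) = w \<bullet> w + c * (w \<bullet> v)"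
      by (simp add: w_def inner_simps inner_commute algebra_simps)
    have "(v + t *\<^sub>R w) \<bullet> (A *v (v + t *\<^sub>R w)) \<le> c * ((v + t *\<^sub>R w) \<bullet> (v + t *\<^sub>R w))"
      using S v w by (intro bound) (auto intro: subspace_add subspace_scale)
    then show ?thesis
      by (simp add: matrix_vector_right_distrib matrix_vector_mult_scaleR inner_simps 1 2 vv
          c_def[symmetric] inner_commute[of v w] algebra_simps power2_eq_square)
  qed
  \<comment> \<open>The linear term of a quadratic that is nonpositive everywhere and vanishes at 0 is zero.\<close>
  have "w = 0"
  proof (rule ccontr)
    assume "w \<noteq> 0"
    define a where "a = w \<bullet> w"
    define b where "b = w \<bullet> (A *v w) - c * (w \<bullet> w)"
    \<comment> \<open>Small enough that the quadratic term takes back at most half of the linear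
      term, which leaves at least \<open>t * a > 0\<close>.\<close>
    define t where "t = a / (\<bar>b\<bar> + 1)"
    have a: "a > 0" using \<open>w \<noteq> 0\<close> by (simp add: a_def)
    have t: "t > 0" using a by (simp add: t_def)
    have "t * (\<bar>b\<bar> + 1) = a" by (simp add: t_def)
    then have "t * (- b) \<le> a"
      using t mult_left_mono[of "-b" "\<bar>b\<bar> + 1" t] by linarith
    then have "t * (a + t * b) \<ge> 0" using t by simp
    moreover have "t * a > 0" using t a by simp
    moreover have "2 * t * a + t\<^sup>2 * b \<le> 0" using quad[of t] by (simp add: a_def b_def)
    ultimately show False by (simp add: algebra_simps power2_eq_square)
  qed
  then show ?thesis using that v by (simp add: w_def)
qed

text \<open>An orthonormal set of eigenvectors of maximal cardinality spans the space: its
  orthogonal complement is invariant under the symmetric \<open>A\<close>, so a nonzero complement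
  would contain one more eigenvector.\<close>

lemma symmetric_matrix_diagonalizable:
  fixes A :: "real^'n^'n"
  assumes A: "transpose A = A"
  obtains P v where "orthogonal_matrix P" "A = P ** diag v ** transpose P"
proof -
  define Q where "Q B \<longleftrightarrow> pairwise orthogonal B \<and> (\<forall>b\<in>B. norm b = 1 \<and> (\<exists>c. A *v b = c *\<^sub>R b))"
    for B :: "(real^'n) set"
  have fin: "finite B \<and> card B \<le> CARD('n) \<and> independent B" if "Q B" for B
  proof -
    have "independent B"
      using that unfolding Q_def by (intro pairwise_orthogonal_independent) auto
    then show ?thesis using independent_bound[of B] by simp
  qed
  \<comment> \<open>\<open>Q\<close> holds for the empty set and bounds cardinalities by the
    dimension, so a largest such set exists.\<close>
  obtain B where B: "Q B" and Bmax: "\<And>C. Q C \<Longrightarrow> card C \<le> card B"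
    using ex_has_greatest_nat[of Q "{}" card "Suc CARD('n)"] fin
    by (metis (no_types, lifting) Q_def empty_iff le_imp_less_Suc pairwise_empty)
  define S where "S = {x. \<forall>b\<in>B. b \<bullet> x = 0}"
  have S: "subspace S" by (auto simp: S_def subspace_def inner_simps)
  have Szero: "z = 0" if "z \<in> S" for z
  proof (rule ccontr)
    assume z: "z \<noteq> 0"
    have "A *v x \<in> S" if "x \<in> S" for x
    proof -
      have "b \<bullet> (A *v x) = 0" if b: "b \<in> B" for b
      proof -
        obtain c where "A *v b = c *\<^sub>R b" using B b unfolding Q_def by blast
        then show ?thesis
          using \<open>x \<in> S\<close> b by (simp add: symmetric_matrix_inner[OF A, symmetric] S_def)
      qed
      then show ?thesis by (simp add: S_def)
    qed
    then obtain v c where v: "v \<in> S" "norm v = 1" "A *v v = c *\<^sub>R v"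
      using symmetric_eigenvector_in_subspace[OF A S _ \<open>z \<in> S\<close> z] by blast
    have "v \<notin> B" using v by (auto simp: S_def)
    have "Q (insert v B)"
      using B v unfolding Q_def
      by (auto simp: pairwise_insert orthogonal_def S_def inner_commute)
    from Bmax[OF this] show False using fin[OF B] \<open>v \<notin> B\<close> by simp
  qed
  have "span B = UNIV"
  proof (rule ccontr)
    assume "span B \<noteq> UNIV"
    then obtain z where "z \<noteq> 0" "\<And>x. x \<in> span B \<Longrightarrow> orthogonal z x"
      using orthogonal_to_subspace_exists_gen[of B UNIV] by (auto simp: psubset_eq)
    then show False using Szero[of z] by (auto simp: S_def orthogonal_def inner_commute span_base)
  qed
  then have "card B = CARD('n)"
    using fin[OF B] by (metis dim_eq_card_independent dim_span dim_UNIV DIM_cart DIM_real mult.right_neutral)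
  \<comment> \<open>Indexing the eigenbasis by the coordinate type lets its members be the columns
    of a square matrix.\<close>
  then obtain h where h: "bij_betw h (UNIV :: 'n set) B"
    using fin[OF B] finite_same_card_bij[of "UNIV :: 'n set" B] by auto
  then have hB: "h j \<in> B" and hi: "i \<noteq> j \<Longrightarrow> h i \<noteq> h j" for i j
    by (auto simp: bij_betw_def inj_on_def)
  have "\<forall>j. \<exists>c. A *v h j = c *\<^sub>R h j" using B hB unfolding Q_def by blast
  then obtain c where c: "\<And>j. A *v h j = c j *\<^sub>R h j" by metis
  define P :: "real^'n^'n" where "P = (\<chi> i j. h j $ i)"
  have col: "column j P = h j" for j by (simp add: P_def column_def vec_eq_iff)
  have P: "orthogonal_matrix P"
    unfolding orthogonal_matrix_orthonormal_columns col
    using B hB hi unfolding Q_def pairwise_def by metis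
  have "A ** P = P ** diag (\<chi> i. c i)"
  proof -
    have "(A ** P) $ i $ j = (A *v h j) $ i" for i j
      by (simp add: matrix_matrix_mult_def matrix_vector_mult_def P_def)
    moreover have "(P ** diag (\<chi> i. c i)) $ i $ j = (c j *\<^sub>R h j) $ i" for i j
      by (simp add: matrix_matrix_mult_def P_def diag_def if_distrib[of "\<lambda>a. _ * a"] cong: if_cong)
    ultimately show ?thesis by (simp add: vec_eq_iff c)
  qed
  then have "A = P ** diag (\<chi> i. c i) ** transpose P"
    using P by (metis matrix_mul_assoc matrix_mul_rid orthogonal_matrix_def)
  with P show ?thesis using that by blast
qed

subsection \<open>Polar decomposition\<close>

lemma inner_matrix_vector_transpose:
  fixes A :: "real^'n^'m"
  shows "x \<bullet> (A *v y) = (transpose A *v x) \<bullet> y"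
  by (simp add: dot_lmul_matrix)

text \<open>In the coordinates \<open>transpose P *v x\<close> the quadratic form is a sum of
  squares with positive weights.\<close>

lemma sym_pos_def_conjugate_diag:
  fixes P :: "real^'n^'n"
  assumes P: "orthogonal_matrix P" and v: "\<And>i. v $ i > 0"
  shows "sym_pos_def (P ** diag v ** transpose P)"
  unfolding sym_pos_def_def
proof (intro conjI allI impI)
  show "transpose (P ** diag v ** transpose P) = P ** diag v ** transpose P"
    by (simp add: matrix_transpose_mul transpose_diag matrix_mul_assoc)
  fix x :: "real^'n" assume x: "x \<noteq> 0"
  define y where "y = transpose P *v x"
  have "P *v y = x"
    using P by (simp add: y_def matrix_vector_mul_assoc orthogonal_matrix_def del: transpose_matrix_vector)
  then have "y \<noteq> 0" using x by auto
  then obtain k where k: "y $ k \<noteq> 0" by (auto simp: vec_eq_iff)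
  have "x \<bullet> ((P ** diag v ** transpose P) *v x) = x \<bullet> (P *v (diag v *v y))"
    by (simp only: matrix_vector_mul_assoc[symmetric] y_def)
  also have "\<dots> = (\<Sum>i\<in>UNIV. v $ i * (y $ i)\<^sup>2)"
    unfolding inner_matrix_vector_transpose[of x P] y_def[symmetric]
    by (simp add: inner_vec_def diag_mult_vector power2_eq_square mult_ac)
  also have "\<dots> > 0"
    using v k by (intro sum_pos2[of _ k]) (auto simp: less_imp_le)
  finally show "x \<bullet> ((P ** diag v ** transpose P) *v x) > 0" .
qed

lemma conjugate_mult_conjugate:
  assumes "orthogonal_matrix P"
  shows "(P ** A ** transpose P) ** (P ** B ** transpose P) = P ** (A ** B) ** transpose (P :: real^'n^'n)"
proof -
  have "(P ** A ** transpose P) ** (P ** B ** transpose P) = P ** A ** (transpose P ** P) ** B ** transpose P"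
    by (simp only: matrix_mul_assoc)
  also have "transpose P ** P = mat 1" using assms by (simp add: orthogonal_matrix_def)
  finally show ?thesis by (simp add: matrix_mul_assoc)
qed

text \<open>Diagonalize the symmetric matrix \<open>U - V\<close>. On an eigenvector
  \<open>x\<close> with eigenvalue \<open>d\<close> the norms of \<open>U *v x\<close> and
  \<open>V *v x\<close> agree, so \<open>d\<close> times the positive number
  \<open>x \<bullet> (U *v x) + x \<bullet> (V *v x)\<close> vanishes.\<close>

lemma sym_pos_def_square_root_unique:
  fixes U V :: "real^'n^'n"
  assumes U: "sym_pos_def U" and V: "sym_pos_def V" and eq: "U ** U = V ** V"
  shows "U = V"
proof -
  have UV: "transpose U = U" "transpose V = V" using U V by (auto simp: sym_pos_def_def)
  have "transpose (U - V) = U - V" using UV by (simp add: transpose_def vec_eq_iff)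
  then obtain P v where P: "orthogonal_matrix P" and D: "U - V = P ** diag v ** transpose P"
    by (rule symmetric_matrix_diagonalizable)
  have "v $ i = 0" for i
  proof -
    define x where "x = P *v axis i 1"
    have tx: "transpose P *v x = axis i 1"
      using P by (simp add: x_def matrix_vector_mul_assoc orthogonal_matrix_def)
    then have "x \<noteq> 0" by (metis axis_eq_0_iff matrix_vector_mult_0_right zero_neq_one)
    then have pos: "x \<bullet> (U *v x) + x \<bullet> (V *v x) > 0"
      using U V by (auto simp: sym_pos_def_def add_pos_pos)
    have "diag v *v axis i 1 = v $ i *\<^sub>R axis i 1"
      by (simp add: vec_eq_iff diag_mult_vector axis_def)
    then have "(U - V) *v x = v $ i *\<^sub>R x"
      unfolding D matrix_vector_mul_assoc[symmetric] tx by (simp add: x_def matrix_vector_mult_scaleR)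
    then have d: "U *v x = V *v x + v $ i *\<^sub>R x"
      by (simp add: matrix_vector_mult_diff_rdistrib algebra_simps)
    have "(U *v x) \<bullet> (U *v x) = (V *v x) \<bullet> (V *v x)"
      using eq by (simp add: inner_matrix_vector_transpose UV matrix_vector_mul_assoc)
    then have "v $ i * (x \<bullet> (U *v x) + x \<bullet> (V *v x)) = 0"
      unfolding d by (simp add: inner_simps inner_commute algebra_simps)
    then show ?thesis using pos by simp
  qed
  then have "diag v = 0" by (simp add: diag_def vec_eq_iff)
  then show ?thesis using D by simp
qed

text \<open>Uniqueness of the positive definite root lets any explicit root be identified with the
  definite description.\<close>

lemma right_stretch_eqI:
  assumes "sym_pos_def U" "U ** U = transpose F ** F"
  shows "right_stretch F = U"
  unfolding right_stretch_def
  using assms by (intro the_equality) (auto intro: sym_pos_def_square_root_unique)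

text \<open>The stretch is built by taking square roots of the eigenvalues of
  \<open>transpose F ** F\<close>, so the same \<open>P\<close> diagonalizes both matrices; the
  rotation is \<open>F\<close> times the inverse stretch.\<close>

lemma polar_decomposition:
  fixes F :: "real^'n^'n"
  assumes F: "det F > 0"
  obtains Q P v where "rotation_matrix Q" "F = Q ** right_stretch F" "sym_pos_def (right_stretch F)"
    "right_stretch F ** right_stretch F = transpose F ** F"
    "orthogonal_matrix P" "right_stretch F = P ** diag v ** transpose P"
proof -
  have "transpose (transpose F ** F) = transpose F ** F" by (simp add: matrix_transpose_mul)
  then obtain P c where P: "orthogonal_matrix P" and c: "transpose F ** F = P ** diag c ** transpose P"
    by (rule symmetric_matrix_diagonalizable)
  \<comment> \<open>The eigenvalue is the squared length of \<open>F *v x\<close> for the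
    \<open>i\<close>-th column \<open>x\<close> of \<open>P\<close>, and \<open>F\<close> is
    injective.\<close>
  have cpos: "c $ i > 0" for i
  proof -
    define x where "x = P *v axis i 1"
    have tx: "transpose P *v x = axis i 1"
      using P by (simp add: x_def matrix_vector_mul_assoc orthogonal_matrix_def)
    then have "x \<noteq> 0" by (metis axis_eq_0_iff matrix_vector_mult_0_right zero_neq_one)
    moreover obtain H where "H ** F = mat 1"
      using F invertible_det_nz[of F] by (auto simp: invertible_def)
    ultimately have "F *v x \<noteq> 0"
      by (metis matrix_vector_mul_assoc matrix_vector_mul_lid matrix_vector_mult_0_right)
    have "(F *v x) \<bullet> (F *v x) = x \<bullet> ((transpose F ** F) *v x)"
      by (simp add: inner_matrix_vector_transpose inner_commute matrix_vector_mul_assoc[symmetric])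
    also have "\<dots> = c $ i"
      unfolding c matrix_vector_mul_assoc[symmetric] tx
      unfolding inner_matrix_vector_transpose[of x P] tx inner_axis' diag_mult_vector by simp
    finally show ?thesis using \<open>F *v x \<noteq> 0\<close> by (metis inner_gt_zero_iff)
  qed
  define v where "v = (\<chi> i. sqrt (c $ i))"
  define U where "U = P ** diag v ** transpose P"
  define V where "V = P ** diag (\<chi> i. 1 / v $ i) ** transpose P"
  have v: "v $ i > 0" for i using cpos by (simp add: v_def)
  have U: "sym_pos_def U" unfolding U_def by (rule sym_pos_def_conjugate_diag[OF P v])
  have "sym_pos_def V" unfolding V_def by (rule sym_pos_def_conjugate_diag[OF P]) (simp add: v)
  then have tV: "transpose V = V" by (simp add: sym_pos_def_def)
  have "diag (\<chi> i. 1) = (mat 1 :: real^'n^'n)" by (simp add: diag_def mat_def vec_eq_iff)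
  then have UV: "U ** V = mat 1" "V ** U = mat 1"
    using P less_imp_neq[OF v]
    by (simp_all add: U_def V_def conjugate_mult_conjugate diag_mult_diag orthogonal_matrix_def)
  have UU: "U ** U = transpose F ** F"
    using P by (simp add: U_def conjugate_mult_conjugate diag_mult_diag c v_def less_imp_le[OF cpos])
  have RS: "right_stretch F = U" using U UU by (rule right_stretch_eqI)
  define Q where "Q = F ** V"
  have QU: "F = Q ** U" by (simp add: Q_def UV flip: matrix_mul_assoc)
  have "transpose Q ** Q = V ** (U ** U) ** V"
    by (simp add: Q_def matrix_transpose_mul tV UU matrix_mul_assoc)
  also have "\<dots> = (V ** U) ** (U ** V)" by (simp only: matrix_mul_assoc)
  finally have Q: "orthogonal_matrix Q" by (simp add: orthogonal_matrix UV)
  \<comment> \<open>Orthogonality leaves \<open>det Q\<close> equal to 1 or -1; positivity of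
    \<open>det F\<close> and \<open>det U\<close> selects 1.\<close>
  have "det (diag v) > 0"
    using v by (subst det_diagonal) (auto simp: diag_def intro!: prod_pos)
  then have "det U > 0"
    using det_orthogonal_matrix[OF P] by (auto simp: U_def det_mul)
  then have "det Q > 0" using F QU by (metis det_mul zero_less_mult_pos2)
  then have "rotation_matrix Q" using Q det_orthogonal_matrix[OF Q] by (auto simp: rotation_matrix_def)
  then show ?thesis using that QU U UU P unfolding RS by (metis U_def)
qed

text \<open>\<open>R1\<close> cancels in \<open>transpose F ** F\<close> and \<open>R2\<close>
  conjugates it; the conjugated stretch is a positive definite root of the result, hence the stretch
  by uniqueness.\<close>

lemma right_stretch_rotate:
  fixes F :: "real^'n^'n"
  assumes F: "det F > 0" and R1: "orthogonal_matrix R1" and R2: "orthogonal_matrix R2"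
  shows "right_stretch (R1 ** F ** R2) = transpose R2 ** right_stretch F ** R2"
proof -
  have U: "sym_pos_def (right_stretch F)"
    and UU: "right_stretch F ** right_stretch F = transpose F ** F"
    by (rule polar_decomposition[OF F], assumption)+
  have R: "orthogonal_matrix (transpose R2)" using R2 by simp
  show ?thesis
  proof (rule right_stretch_eqI)
    show "sym_pos_def (transpose R2 ** right_stretch F ** R2)"
      unfolding sym_pos_def_def
    proof (intro conjI allI impI)
      show "transpose (transpose R2 ** right_stretch F ** R2) = transpose R2 ** right_stretch F ** R2"
        using U by (simp add: sym_pos_def_def matrix_transpose_mul matrix_mul_assoc)
      fix x :: "real^'n" assume x: "x \<noteq> 0"
      have "transpose R2 *v (R2 *v x) = x"
        using R2 by (simp add: matrix_vector_mul_assoc orthogonal_matrix_def del: transpose_matrix_vector)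
      then have "R2 *v x \<noteq> 0" using x by auto
      then show "x \<bullet> ((transpose R2 ** right_stretch F ** R2) *v x) > 0"
        using U unfolding sym_pos_def_def
        by (simp add: inner_matrix_vector_transpose[of x "transpose R2"] del: transpose_matrix_vector
            flip: matrix_vector_mul_assoc)
    qed
    have "transpose (R1 ** F ** R2) ** (R1 ** F ** R2)
        = transpose R2 ** transpose F ** (transpose R1 ** R1) ** F ** R2"
      by (simp add: matrix_transpose_mul matrix_mul_assoc)
    also have "transpose R1 ** R1 = mat 1" using R1 by (simp add: orthogonal_matrix_def)
    finally show "(transpose R2 ** right_stretch F ** R2) ** (transpose R2 ** right_stretch F ** R2)
        = transpose (R1 ** F ** R2) ** (R1 ** F ** R2)"
      using conjugate_mult_conjugate[OF R, of "right_stretch F" "right_stretch F"]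
      by (simp add: UU matrix_mul_assoc)
  qed
qed

subsection \<open>Convex and lower semicontinuous functions\<close>

text \<open>Strict superlevel sets turn suprema into unions and compositions into preimages, so
  closure under both becomes immediate.\<close>

lemma lsc_fun_iff_open: "lsc_fun f \<longleftrightarrow> (\<forall>c. open {x. c < f x})"
proof
  assume f: "lsc_fun f"
  show "\<forall>c. open {x. c < f x}"
  proof
    fix c
    show "open {x. c < f x}"
    proof (rule open_subopen[THEN iffD2], rule ballI)
      fix x assume "x \<in> {x. c < f x}"
      \<comment> \<open>\<open>Liminf (at x)\<close> sees only a punctured neighbourhood; the
        assumption at \<open>x\<close> itself fills the hole.\<close>
      then have "eventually (\<lambda>y. y \<in> {x. c < f x}) (nhds x)"
        using f by (simp add: lsc_fun_def le_Liminf_iff eventually_nhds_conv_at)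
      then show "\<exists>T. open T \<and> x \<in> T \<and> T \<subseteq> {x. c < f x}"
        unfolding eventually_nhds subset_eq by assumption
    qed
  qed
next
  assume f: "\<forall>c. open {x. c < f x}"
  show "lsc_fun f"
    unfolding lsc_fun_def le_Liminf_iff
  proof (intro allI impI)
    fix x c assume "c < f x"
    then show "eventually (\<lambda>y. c < f y) (at x)"
      unfolding eventually_at_topological using f by (intro exI[of _ "{x. c < f x}"]) simp
  qed
qed

lemma lsc_fun_SUP:
  assumes "\<And>i. i \<in> I \<Longrightarrow> lsc_fun (f i)"
  shows "lsc_fun (\<lambda>x. SUP i\<in>I. f i x)"
proof -
  have "{x. c < (SUP i\<in>I. f i x)} = (\<Union>i\<in>I. {x. c < f i x})" for c
    by (auto simp: less_SUP_iff)
  then show ?thesis using assms by (simp add: lsc_fun_iff_open open_UN)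
qed

lemma lsc_fun_compose:
  assumes f: "lsc_fun f" and g: "continuous_on UNIV g"
  shows "lsc_fun (\<lambda>x. f (g x))"
  unfolding lsc_fun_iff_open
proof
  fix c
  have "{x. c < f (g x)} = g -` {x. c < f x}" by auto
  then show "open {x. c < f (g x)}"
    using open_vimage[OF _ g, of "{x. c < f x}"] f by (simp add: lsc_fun_iff_open)
qed

lemma convex_fun_SUP:
  fixes f :: "'i \<Rightarrow> 'a::real_vector \<Rightarrow> ereal"
  assumes "\<And>i. i \<in> I \<Longrightarrow> convex_fun (f i)"
  shows "convex_fun (\<lambda>x. SUP i\<in>I. f i x)"
  unfolding convex_fun_def
proof (intro allI impI SUP_least)
  fix x y :: 'a and u v :: real and i
  assume uv: "u \<ge> 0" "v \<ge> 0" "u + v = 1" and i: "i \<in> I"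
  have "f i (u *\<^sub>R x + v *\<^sub>R y) \<le> ereal u * f i x + ereal v * f i y"
    using assms[OF i] uv by (auto simp: convex_fun_def)
  also have "\<dots> \<le> ereal u * (SUP i\<in>I. f i x) + ereal v * (SUP i\<in>I. f i y)"
    using uv i by (intro add_mono ereal_mult_left_mono SUP_upper) auto
  finally show "f i (u *\<^sub>R x + v *\<^sub>R y) \<le> \<dots>" .
qed

lemma convex_fun_compose_linear:
  assumes "convex_fun f" "linear g"
  shows "convex_fun (\<lambda>x. f (g x))"
  using assms by (simp add: convex_fun_def linear_add linear_scale)

text \<open>This turns the upper bound on the supremum into membership in a convex set. Splitting
  \<open>c\<close> into two multiples is sound also for infinite \<open>c\<close>, because both
  weights are nonnegative.\<close>

lemma convex_sublevel:
  assumes "convex_fun f"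
  shows "convex {x. f x \<le> c}"
proof (rule convexI)
  fix x y and u v :: real
  assume xy: "x \<in> {x. f x \<le> c}" "y \<in> {x. f x \<le> c}" and uv: "u \<ge> 0" "v \<ge> 0" "u + v = 1"
  have "f (u *\<^sub>R x + v *\<^sub>R y) \<le> ereal u * f x + ereal v * f y"
    using assms uv by (auto simp: convex_fun_def)
  also have "\<dots> \<le> ereal u * c + ereal v * c"
    using xy uv by (intro add_mono ereal_mult_left_mono) auto
  also have "\<dots> = c"
    using uv by (metis ereal_left_distrib ereal_less_eq(5) lambda_one one_ereal_def plus_ereal.simps(1))
  finally show "u *\<^sub>R x + v *\<^sub>R y \<in> {x. f x \<le> c}" by simp
qed

subsection \<open>Invariants and rotations\<close>

text \<open>Cyclicity moves the eigenbasis of the stretch over to the rotation, leaving a trace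
  against a diagonal matrix.\<close>

lemma trace_mult_conjugate:
  fixes P :: "real^'n^'n"
  shows "trace (S ** (P ** A ** transpose P)) = trace (transpose P ** S ** P ** A)"
  using trace_mul_sym[of "S ** P ** A" "transpose P"] by (simp add: matrix_mul_assoc)

lemma trace_conjugate:
  fixes P :: "real^'n^'n"
  assumes "orthogonal_matrix P"
  shows "trace (P ** A ** transpose P) = trace A"
  using trace_mul_sym[of "P ** A" "transpose P"] assms
  by (simp add: matrix_mul_assoc orthogonal_matrix_def)

lemma det_conjugate:
  fixes P :: "real^'n^'n"
  assumes "orthogonal_matrix P"
  shows "det (P ** A ** transpose P) = det A"
  using det_orthogonal_matrix[OF assms] by (auto simp: det_mul)

lemma rotation_matrix_mul: "rotation_matrix A \<Longrightarrow> rotation_matrix B \<Longrightarrow> rotation_matrix (A ** (B :: real^'n^'n))"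
  by (simp add: rotation_matrix_def orthogonal_matrix_mul det_mul)

lemma rotation_matrix_conjugate:
  fixes P :: "real^'n^'n"
  assumes "orthogonal_matrix P" "rotation_matrix R"
  shows "rotation_matrix (transpose P ** R ** P)"
  using assms det_orthogonal_matrix[OF assms(1)]
  by (auto simp: rotation_matrix_def orthogonal_matrix_mul det_mul)

lemma linear_trace_mult: "linear (\<lambda>F :: real^'n^'n. trace (R ** F))"
  by (intro linearI) (simp add: matrix_add_ldistrib trace_add, simp add: trace_def
      matrix_matrix_mult_def sum_distrib_left mult_ac)

lemma linear_vector_2:
  assumes "linear (f :: 'a::real_vector \<Rightarrow> real)" "linear g"
  shows "linear (\<lambda>x. vector [f x, g x] :: real^2)"
  using assms by (intro linearI) (simp_all add: vec_eq_iff forall_2 linear_add linear_scale)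

lemma linear_vector_3:
  assumes "linear (f :: 'a::real_vector \<Rightarrow> real)" "linear g" "linear h"
  shows "linear (\<lambda>x. vector [f x, g x, h x] :: real^3)"
  using assms by (intro linearI) (simp_all add: vec_eq_iff forall_3 linear_add linear_scale)

section \<open>Adjugates of products and of orthogonal conjugates\<close>

lemma adj3_mult: "adj3 (A ** B) = adj3 B ** adj3 A"
  by (simp add: adj3_def vec_eq_iff forall_3 matrix_matrix_mult_def sum_3 algebra_simps)

text \<open>Multiply \<open>mult_adj3\<close> by the transpose from the left. In particular a
  rotation is its own cofactor matrix.\<close>

lemma adj3_orthogonal:
  assumes "orthogonal_matrix P"
  shows "adj3 P = det P *\<^sub>R transpose P"
proof -
  have "adj3 P = transpose P ** (P ** adj3 P)"
    using assms by (simp add: matrix_mul_assoc orthogonal_matrix_def)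
  also have "\<dots> = det P *\<^sub>R transpose P"
    unfolding mult_adj3
    by (simp add: vec_eq_iff forall_3 matrix_matrix_mult_def mat_def sum_3)
  finally show ?thesis .
qed

text \<open>The adjugates of \<open>P\<close> and of its transpose each contribute a factor
  \<open>det P\<close>, and these two signs cancel.\<close>

lemma adj3_conjugate:
  assumes P: "orthogonal_matrix P"
  shows "adj3 (P ** A ** transpose P) = P ** adj3 A ** transpose P"
proof -
  have "adj3 (transpose P) = det P *\<^sub>R P"
    using adj3_orthogonal[of "transpose P"] P by simp
  then show ?thesis
    using det_orthogonal_matrix[OF P]
    by (auto simp: adj3_mult adj3_orthogonal[OF P] matrix_mul_assoc matrix_scalar_ac
        simp flip: scalar_matrix_assoc)
qed

lemma inv2_conjugate: "orthogonal_matrix P \<Longrightarrow> inv2 (P ** A ** transpose P) = inv2 A"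
  by (simp add: inv2_def trace_conjugate det_conjugate)

lemma inv3_conjugate: "orthogonal_matrix P \<Longrightarrow> inv3 (P ** A ** transpose P) = inv3 A"
  by (simp add: inv3_def trace_conjugate det_conjugate adj3_conjugate)

lemma inv2_diag: "inv2 (diag v) = e2 v"
  by (simp add: inv2_def e2_def diag_def trace_def det_2 sum_2)

lemma inv3_diag: "inv3 (diag v) = e3 v"
  by (simp add: inv3_def e3_def diag_def trace_def adj3_def det_3 sum_3)

section \<open>Diagonals of rotations as convex combinations of sign vectors\<close>

lemma trace_mult_diag: "trace (S ** diag v) = (\<Sum>i\<in>UNIV. S $ i $ i * v $ i)"
  by (simp add: trace_def matrix_matrix_mult_def diag_def if_distrib[of "\<lambda>a. _ * a"] cong: if_cong)

lemma det_diag: "det (diag v) = (\<Prod>i\<in>UNIV. v $ i)"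
  by (subst det_diagonal) (simp_all add: diag_def)

lemma transpose_adj3_diag:
  "transpose (adj3 (diag v)) = diag (vector [v$2 * v$3, v$1 * v$3, v$1 * v$2])"
  by (simp add: vec_eq_iff forall_3 adj3_def diag_def transpose_def)

text \<open>Both diagonal entries of a planar rotation equal the cosine of its angle, so the
  diagonal lies on the segment between (1, 1) and (-1, -1). The trace is linear in the diagonal, and
  the determinant is the same at both ends.\<close>

lemma rotation2_trace_in_convex:
  assumes S: "rotation_matrix (S :: real^2^2)" and C: "convex C"
    and e: "\<And>\<epsilon>. \<forall>i. \<epsilon> $ i \<in> {-1, 1} \<Longrightarrow> (\<Prod>i\<in>UNIV. \<epsilon> $ i) = 1 \<Longrightarrow> e2 (diag \<epsilon> *v v) \<in> C"
  shows "vector [trace (S ** diag v), det (diag v)] \<in> C"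
proof -
  have o: "transpose S ** S = mat 1" "det S = 1"
    using S by (auto simp: rotation_matrix_def orthogonal_matrix_def)
  have r: "S$1$1 * S$1$1 + S$2$1 * S$2$1 = 1" "S$1$2 * S$1$2 + S$2$2 * S$2$2 = 1"
    "S$1$1 * S$1$2 + S$2$1 * S$2$2 = 0" "S$1$1 * S$2$2 - S$1$2 * S$2$1 = 1"
    using o by (simp_all add: vec_eq_iff forall_2 matrix_matrix_mult_def transpose_def mat_def sum_2 det_2)
  have eq: "S$2$2 = S$1$1" using r by algebra
  have "(S$1$1)\<^sup>2 \<le> 1" using r(1) by (simp add: power2_eq_square) (metis le_add_same_cancel1 zero_le_square)
  then have b: "\<bar>S$1$1\<bar> \<le> 1" by (simp add: abs_square_le_1)
  have "vector [trace (S ** diag v), det (diag v)]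
    = ((1 + S$1$1) / 2) *\<^sub>R e2 (diag (vector [1, 1]) *v v)
      + ((1 - S$1$1) / 2) *\<^sub>R e2 (diag (vector [-1, -1]) *v v)"
    by (simp add: vec_eq_iff forall_2 e2_def diag_mult_vector trace_mult_diag det_diag UNIV_2 eq field_simps)
  also have "\<dots> \<in> C"
    using b by (intro convexD[OF C] e) (auto simp: forall_2 UNIV_2 field_simps)
  finally show ?thesis .
qed

text \<open>These are the four face inequalities of the tetrahedron whose vertices are the sign
  vectors with product 1.\<close>

lemma rotation3_diagonal_bounds:
  assumes S: "rotation_matrix (S :: real^3^3)"
  shows "\<bar>S$2$2 + S$3$3\<bar> \<le> 1 + S$1$1" "\<bar>S$2$2 - S$3$3\<bar> \<le> 1 - S$1$1"
proof -
  have o: "transpose S ** S = mat 1" "S ** transpose S = mat 1" "adj3 S = transpose S"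
    using S adj3_orthogonal[of S] by (auto simp: rotation_matrix_def orthogonal_matrix_def)
  have 1: "S$1$1 * S$1$1 + S$1$2 * S$1$2 + S$1$3 * S$1$3 = 1"
    "S$2$1 * S$2$1 + S$2$2 * S$2$2 + S$2$3 * S$2$3 = 1"
    "S$3$1 * S$3$1 + S$3$2 * S$3$2 + S$3$3 * S$3$3 = 1"
    using o(2) by (simp_all add: vec_eq_iff forall_3 matrix_matrix_mult_def transpose_def mat_def sum_3)
  have 2: "S$1$1 * S$1$1 + S$2$1 * S$2$1 + S$3$1 * S$3$1 = 1"
    using o(1) by (simp add: vec_eq_iff forall_3 matrix_matrix_mult_def transpose_def mat_def sum_3)
  have 3: "S$2$2 * S$3$3 - S$2$3 * S$3$2 = S$1$1"
    using o(3) by (simp add: vec_eq_iff forall_3 adj3_def transpose_def)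
  \<comment> \<open>Rows two and three and column one show that the squares of the four entries of
    the lower right block sum to \<open>1 + (S$1$1)\<^sup>2\<close>; the cofactor identity
    \<open>3\<close> supplies the mixed terms.\<close>
  have "(1 + S$1$1)\<^sup>2 - (S$2$2 + S$3$3)\<^sup>2 = (S$2$3 - S$3$2)\<^sup>2"
    "(1 - S$1$1)\<^sup>2 - (S$2$2 - S$3$3)\<^sup>2 = (S$2$3 + S$3$2)\<^sup>2"
    using 1 2 3 by algebra+
  then have sq: "(S$2$2 + S$3$3)\<^sup>2 \<le> (1 + S$1$1)\<^sup>2" "(S$2$2 - S$3$3)\<^sup>2 \<le> (1 - S$1$1)\<^sup>2"
    by (metis diff_ge_0_iff_ge zero_le_power2)+
  \<comment> \<open>Makes \<open>1 + S$1$1\<close> and \<open>1 - S$1$1\<close> nonnegative, so that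
    roots can be taken in \<open>sq\<close>.\<close>
  have "(S$1$1)\<^sup>2 \<le> 1"
    using 1(1) zero_le_square[of "S$1$2"] zero_le_square[of "S$1$3"] unfolding power2_eq_square by linarith
  then have "\<bar>S$1$1\<bar> \<le> 1" by (simp add: abs_square_le_1)
  then show "\<bar>S$2$2 + S$3$3\<bar> \<le> 1 + S$1$1" "\<bar>S$2$2 - S$3$3\<bar> \<le> 1 - S$1$1"
    using sq by (auto simp: abs_le_square_iff[symmetric])
qed

lemma prod_3: "(\<Prod>i\<in>UNIV. f (i :: 3)) = f 1 * f 2 * f 3"
  unfolding UNIV_3 by (simp add: ac_simps)

lemma convex_4:
  assumes "convex C" "p \<in> C" "q \<in> C" "r \<in> C" "s \<in> C"
    "0 \<le> a" "0 \<le> b" "0 \<le> c" "0 \<le> d" "a + b + c + d = 1"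
  shows "a *\<^sub>R p + b *\<^sub>R q + c *\<^sub>R r + d *\<^sub>R s \<in> C"
proof -
  have I: "i < 4 \<longleftrightarrow> i = 0 \<or> i = 1 \<or> i = 2 \<or> i = 3" for i :: nat by auto
  have "(\<Sum>i<4. ([a, b, c, d] ! i) *\<^sub>R ([p, q, r, s] ! i)) \<in> C"
  proof (rule convex_sum)
    show "(\<Sum>i<4. [a, b, c, d] ! i) = 1" using assms by (simp add: eval_nat_numeral)
    show "[a, b, c, d] ! i \<ge> 0" "[p, q, r, s] ! i \<in> C" if "i \<in> {..<4}" for i
      using that assms by (auto simp: I)
  qed (use assms in auto)
  then show ?thesis by (simp add: eval_nat_numeral)
qed

text \<open>For signs with product 1, the product of two of them is the third. Hence flipping signs
  multiplies \<open>v$2 * v$3\<close> by the same sign as \<open>v$1\<close>, and cyclically, so one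
  set of weights serves both traces.\<close>

lemma rotation3_trace_in_convex:
  assumes S: "rotation_matrix (S :: real^3^3)" and C: "convex C"
    and e: "\<And>\<epsilon>. \<forall>i. \<epsilon> $ i \<in> {-1, 1} \<Longrightarrow> (\<Prod>i\<in>UNIV. \<epsilon> $ i) = 1 \<Longrightarrow> e3 (diag \<epsilon> *v v) \<in> C"
  shows "vector [trace (S ** diag v), trace (S ** transpose (adj3 (diag v))), det (diag v)] \<in> C"
proof -
  have coeffs: "0 \<le> (1 + S$1$1 + S$2$2 + S$3$3) / 4" "0 \<le> (1 + S$1$1 - S$2$2 - S$3$3) / 4"
    "0 \<le> (1 - S$1$1 + S$2$2 - S$3$3) / 4" "0 \<le> (1 - S$1$1 - S$2$2 + S$3$3) / 4"
    using rotation3_diagonal_bounds[OF S] by auto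
  have comp: "e3 (diag (vector [1, 1, 1]) *v v) = vector [v$1 + v$2 + v$3, v$2 * v$3 + v$1 * v$3 + v$1 * v$2, v$1 * v$2 * v$3]"
    "e3 (diag (vector [1, -1, -1]) *v v) = vector [v$1 - v$2 - v$3, v$2 * v$3 - v$1 * v$3 - v$1 * v$2, v$1 * v$2 * v$3]"
    "e3 (diag (vector [-1, 1, -1]) *v v) = vector [v$2 - v$1 - v$3, v$1 * v$3 - v$2 * v$3 - v$1 * v$2, v$1 * v$2 * v$3]"
    "e3 (diag (vector [-1, -1, 1]) *v v) = vector [- v$1 - v$2 + v$3, - (v$2 * v$3) - v$1 * v$3 + v$1 * v$2, v$1 * v$2 * v$3]"
    by (simp_all add: e3_def diag_mult_vector)
  have tr: "trace (S ** diag v) = S$1$1 * v$1 + S$2$2 * v$2 + S$3$3 * v$3"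
    "trace (S ** transpose (adj3 (diag v)))
      = S$1$1 * (v$2 * v$3) + S$2$2 * (v$1 * v$3) + S$3$3 * (v$1 * v$2)"
    "det (diag v) = v$1 * v$2 * v$3"
    by (simp_all add: trace_mult_diag transpose_adj3_diag det_diag sum_3 prod_3)
  \<comment> \<open>The weights are the barycentric coordinates of the diagonal of \<open>S\<close>
    in the tetrahedron of sign vectors.\<close>
  have "vector [trace (S ** diag v), trace (S ** transpose (adj3 (diag v))), det (diag v)]
    = ((1 + S$1$1 + S$2$2 + S$3$3) / 4) *\<^sub>R e3 (diag (vector [1, 1, 1]) *v v)
    + ((1 + S$1$1 - S$2$2 - S$3$3) / 4) *\<^sub>R e3 (diag (vector [1, -1, -1]) *v v)
    + ((1 - S$1$1 + S$2$2 - S$3$3) / 4) *\<^sub>R e3 (diag (vector [-1, 1, -1]) *v v)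
    + ((1 - S$1$1 - S$2$2 + S$3$3) / 4) *\<^sub>R e3 (diag (vector [-1, -1, 1]) *v v)"
    unfolding comp tr vec_eq_iff forall_3 vector_3 vector_add_component
      vector_scaleR_component real_scaleR_def
    by (intro conjI; simp add: field_simps)
  also have "\<dots> \<in> C"
    by (intro convex_4[OF C] e coeffs) (simp_all add: forall_3 prod_3 field_simps)
  finally show ?thesis .
qed

subsection \<open>Polyconvexity\<close>

text \<open>Rotating \<open>F\<close> preserves its determinant and only conjugates its stretch, to
  which \<open>f\<close> is insensitive.\<close>

lemma isotropic_stretch_invariant:
  fixes W :: "real^'n^'n \<Rightarrow> ereal"
  assumes W: "\<And>F. W F = (if det F > 0 then f (right_stretch F) else \<infinity>)"
    and f: "\<And>P A. orthogonal_matrix P \<Longrightarrow> f (P ** A ** transpose P) = f A"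
  shows "isotropic W"
  unfolding isotropic_def
proof (intro allI impI)
  fix F R1 R2 :: "real^'n^'n"
  assume "rotation_matrix R1 \<and> rotation_matrix R2"
  then have R: "orthogonal_matrix R1" "orthogonal_matrix R2" and d: "det (R1 ** F ** R2) = det F"
    by (auto simp: rotation_matrix_def det_mul)
  show "W F = W (R1 ** F ** R2)"
  proof (cases "det F > 0")
    case True
    then show ?thesis
      using f[of "transpose R2" "right_stretch F"] R by (simp add: W d right_stretch_rotate)
  qed (simp add: W d)
qed

lemma rotation_matrix_id: "rotation_matrix (mat 1 :: real^'n^'n)"
  by (simp add: rotation_matrix_def orthogonal_matrix_id)

section \<open>Polyconvexity in dimension two\<close>

lemma lsc_polyconvex2_stretch_invariants:
  fixes \<psi> :: "real^2 \<Rightarrow> ereal"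
  assumes fin: "real_or_infty \<psi>" and conv: "convex_fun \<psi>" and lsc: "lsc_fun \<psi>"
    and sgn: "\<And>\<nu> \<epsilon>. \<forall>i. \<epsilon> $ i \<in> {-1, 1} \<Longrightarrow> (\<Prod>i\<in>UNIV. \<epsilon> $ i) = 1 \<Longrightarrow>
      \<psi> (e2 \<nu>) = \<psi> (e2 (diag \<epsilon> *v \<nu>))"
    and inf: "\<And>\<alpha>. \<alpha> $ 2 \<le> 0 \<Longrightarrow> \<psi> \<alpha> = \<infinity>"
    and W: "\<And>F. W F = (if det F > 0 then \<psi> (inv2 (right_stretch F)) else \<infinity>)"
  shows "lsc_polyconvex2 W"
proof -
  define L :: "real^2^2 \<Rightarrow> (real^2^2) \<times> real \<Rightarrow> real^2"
    where "L R x = vector [trace (R ** fst x), snd x]" for R x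
  define G where "G = (\<lambda>x. SUP R\<in>{R. rotation_matrix R}. \<psi> (L R x))"
  have L: "linear (L R)" for R
    unfolding L_def
    by (intro linear_vector_2 linear_compose[OF linear_fst linear_trace_mult, unfolded o_def] linear_snd)
  have ub: "\<psi> (L R x) \<le> G x" if "rotation_matrix R" for R x
    unfolding G_def using that by (intro SUP_upper) simp
  have "G x \<noteq> -\<infinity>" for x
    using ub[OF rotation_matrix_id, of x] fin unfolding real_or_infty_def by (metis ereal_infty_less_eq(2))
  moreover have "lsc_fun G"
    unfolding G_def
    by (rule lsc_fun_SUP, rule lsc_fun_compose[OF lsc])
       (rule linear_continuous_on, simp add: L flip: linear_conv_bounded_linear)
  moreover have "convex_fun G"
    unfolding G_def by (rule convex_fun_SUP, rule convex_fun_compose_linear[OF conv L])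
  moreover have "W F = G (minors2 F)" for F
  proof (cases "det F > 0")
    case False
    \<comment> \<open>The last coordinate of \<open>L R\<close> is the determinant for every
      \<open>R\<close>, so the identity alone makes the supremum infinite.\<close>
    then have "\<psi> (L (mat 1) (minors2 F)) = \<infinity>" by (intro inf) (simp add: L_def minors2_def)
    then show ?thesis using ub[OF rotation_matrix_id, of "minors2 F"] False by (simp add: W)
  next
    case True
    define U where "U = right_stretch F"
    obtain Q P v where Q: "rotation_matrix Q" and QU: "F = Q ** U"
      and P: "orthogonal_matrix P" and U: "U = P ** diag v ** transpose P"
      using polar_decomposition[OF True] unfolding U_def by metis
    have dF: "det F = det (diag v)"
      using Q by (simp add: QU U det_mul[of Q] det_conjugate[OF P] rotation_matrix_def)
    have IU: "inv2 U = e2 v" by (simp add: U inv2_conjugate[OF P] inv2_diag)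
    have "G (minors2 F) \<le> \<psi> (e2 v)"
      unfolding G_def
    proof (rule SUP_least, simp)
      fix R :: "real^2^2" assume R: "rotation_matrix R"
      have "L R (minors2 F) = vector [trace (transpose P ** (R ** Q) ** P ** diag v), det (diag v)]"
        unfolding trace_mult_conjugate[symmetric] U[symmetric]
        by (simp add: L_def minors2_def dF) (simp add: QU matrix_mul_assoc)
      \<comment> \<open>The sign symmetry of \<open>\<psi>\<close> puts every vertex into this
        convex sublevel set.\<close>
      also have "\<dots> \<in> {x. \<psi> x \<le> \<psi> (e2 v)}"
        using sgn[of _ v]
        by (intro rotation2_trace_in_convex rotation_matrix_conjugate rotation_matrix_mul
            convex_sublevel P Q R conv) simp
      finally show "\<psi> (L R (minors2 F)) \<le> \<psi> (e2 v)" by simp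
    qed
    moreover have "\<psi> (e2 v) \<le> G (minors2 F)"
    proof -
      have "transpose Q ** F = U"
        using Q by (simp add: QU matrix_mul_assoc rotation_matrix_def orthogonal_matrix_def)
      moreover have "det F = det U" using Q by (simp add: QU det_mul rotation_matrix_def)
      ultimately have "L (transpose Q) (minors2 F) = inv2 U"
        by (simp add: L_def minors2_def inv2_def)
      then show ?thesis
        using ub[of "transpose Q" "minors2 F"] Q by (simp add: IU rotation_matrix_def)
    qed
    ultimately show ?thesis using True IU by (simp add: W U_def[symmetric])
  qed
  ultimately show ?thesis unfolding lsc_polyconvex2_def real_or_infty_def by blast
qed

section \<open>Polyconvexity in dimension three\<close>

lemma lsc_polyconvex3_stretch_invariants:
  fixes \<psi> :: "real^3 \<Rightarrow> ereal"
  assumes fin: "real_or_infty \<psi>" and conv: "convex_fun \<psi>" and lsc: "lsc_fun \<psi>"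
    and sgn: "\<And>\<nu> \<epsilon>. \<forall>i. \<epsilon> $ i \<in> {-1, 1} \<Longrightarrow> (\<Prod>i\<in>UNIV. \<epsilon> $ i) = 1 \<Longrightarrow>
      \<psi> (e3 \<nu>) = \<psi> (e3 (diag \<epsilon> *v \<nu>))"
    and inf: "\<And>\<alpha>. \<alpha> $ 3 \<le> 0 \<Longrightarrow> \<psi> \<alpha> = \<infinity>"
    and W: "\<And>F. W F = (if det F > 0 then \<psi> (inv3 (right_stretch F)) else \<infinity>)"
  shows "lsc_polyconvex3 W"
proof -
  \<comment> \<open>For a rotation \<open>R\<close>, \<open>trace (adj3 (R ** F))\<close> equals
    \<open>trace (R ** transpose (adj3 F))\<close>, which is linear in the cofactor block.\<close>
  define L :: "real^3^3 \<Rightarrow> (real^3^3) \<times> (real^3^3) \<times> real \<Rightarrow> real^3"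
    where "L R x = vector [trace (R ** fst x), trace (R ** fst (snd x)), snd (snd x)]" for R x
  define G where "G = (\<lambda>x. SUP R\<in>{R. rotation_matrix R}. \<psi> (L R x))"
  have L: "linear (L R)" for R
    unfolding L_def
    by (intro linear_vector_3 linear_compose[OF _ linear_trace_mult, unfolded o_def]
        linear_compose[OF linear_snd linear_fst, unfolded o_def]
        linear_compose[OF linear_snd linear_snd, unfolded o_def] linear_fst)
  have ub: "\<psi> (L R x) \<le> G x" if "rotation_matrix R" for R x
    unfolding G_def using that by (intro SUP_upper) simp
  have "G x \<noteq> -\<infinity>" for x
    using ub[OF rotation_matrix_id, of x] fin unfolding real_or_infty_def by (metis ereal_infty_less_eq(2))
  moreover have "lsc_fun G"
    unfolding G_def
    by (rule lsc_fun_SUP, rule lsc_fun_compose[OF lsc])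
       (rule linear_continuous_on, simp add: L flip: linear_conv_bounded_linear)
  moreover have "convex_fun G"
    unfolding G_def by (rule convex_fun_SUP, rule convex_fun_compose_linear[OF conv L])
  moreover have "W F = G (minors3 F)" for F
  proof (cases "det F > 0")
    case False
    then have "\<psi> (L (mat 1) (minors3 F)) = \<infinity>" by (intro inf) (simp add: L_def minors3_def)
    then show ?thesis using ub[OF rotation_matrix_id, of "minors3 F"] False by (simp add: W)
  next
    case True
    define U where "U = right_stretch F"
    obtain Q P v where Q: "rotation_matrix Q" and QU: "F = Q ** U"
      and P: "orthogonal_matrix P" and U: "U = P ** diag v ** transpose P"
      using polar_decomposition[OF True] unfolding U_def by metis
    have dF: "det F = det (diag v)"
      using Q by (simp add: QU U det_mul[of Q] det_conjugate[OF P] rotation_matrix_def)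
    have IU: "inv3 U = e3 v" by (simp add: U inv3_conjugate[OF P] inv3_diag)
    \<comment> \<open>Taking cofactors is multiplicative and fixes rotations, so the same
      \<open>Q\<close> rotates both matrix blocks and one choice of \<open>R\<close> undoes it in
      both.\<close>
    have cof: "transpose (adj3 F) = Q ** transpose (adj3 U)"
      using Q by (simp add: QU adj3_mult matrix_transpose_mul adj3_orthogonal rotation_matrix_def)
    \<comment> \<open>The same basis diagonalizes the cofactor block, so both traces below involve
      one common conjugated rotation.\<close>
    have cofU: "transpose (adj3 U) = P ** transpose (adj3 (diag v)) ** transpose P"
      by (simp add: U adj3_conjugate[OF P] matrix_transpose_mul matrix_mul_assoc)
    have "G (minors3 F) \<le> \<psi> (e3 v)"
      unfolding G_def
    proof (rule SUP_least, simp)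
      fix R :: "real^3^3" assume R: "rotation_matrix R"
      have "L R (minors3 F) = vector [trace (transpose P ** (R ** Q) ** P ** diag v),
          trace (transpose P ** (R ** Q) ** P ** transpose (adj3 (diag v))), det (diag v)]"
        unfolding trace_mult_conjugate[symmetric] U[symmetric] cofU[symmetric]
        by (simp add: L_def minors3_def dF cof matrix_mul_assoc) (simp add: QU matrix_mul_assoc)
      also have "\<dots> \<in> {x. \<psi> x \<le> \<psi> (e3 v)}"
        using sgn[of _ v]
        by (intro rotation3_trace_in_convex rotation_matrix_conjugate rotation_matrix_mul
            convex_sublevel P Q R conv) simp
      finally show "\<psi> (L R (minors3 F)) \<le> \<psi> (e3 v)" by simp
    qed
    moreover have "\<psi> (e3 v) \<le> G (minors3 F)"
    proof -
      have QQ: "transpose Q ** Q = mat 1" and dQ: "det Q = 1"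
        using Q by (simp_all add: rotation_matrix_def orthogonal_matrix_def)
      have "transpose Q ** F = U"
        using QQ by (simp add: QU matrix_mul_assoc)
      moreover have "transpose Q ** transpose (adj3 F) = transpose (adj3 U)"
        using QQ by (simp add: cof matrix_mul_assoc)
      moreover have "det F = det U" by (simp add: QU det_mul dQ)
      moreover have "trace (transpose (adj3 U)) = trace (adj3 U)" by (simp add: trace_def transpose_def)
      ultimately have "L (transpose Q) (minors3 F) = inv3 U"
        by (simp add: L_def minors3_def inv3_def)
      then show ?thesis
        using ub[of "transpose Q" "minors3 F"] Q by (simp add: IU rotation_matrix_def)
    qed
    ultimately show ?thesis using True IU by (simp add: W U_def[symmetric])
  qed
  ultimately show ?thesis unfolding lsc_polyconvex3_def real_or_infty_def by blast
qed

theorem corollary5p3: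
  shows "(\<forall>(\<psi> :: real^2 \<Rightarrow> ereal) (W :: real^2^2 \<Rightarrow> ereal).
            real_or_infty \<psi> \<and> convex_fun \<psi> \<and> lsc_fun \<psi> \<and>
            (\<forall>\<nu> \<epsilon>. (\<forall>i. \<epsilon> $ i \<in> {-1, 1}) \<and> (\<Prod>i\<in>UNIV. \<epsilon> $ i) = 1 \<longrightarrow>
               \<psi> (e2 \<nu>) = \<psi> (e2 (diag \<epsilon> *v \<nu>))) \<and>
            (\<forall>\<alpha>. \<alpha> $ 2 \<le> 0 \<longrightarrow> \<psi> \<alpha> = \<infinity>) \<and>
            (\<forall>F. W F = (if det F > 0 then \<psi> (inv2 (right_stretch F)) else \<infinity>))
          \<longrightarrow> isotropic W \<and> lsc_polyconvex2 W)
       \<and> (\<forall>(\<psi> :: real^3 \<Rightarrow> ereal) (W :: real^3^3 \<Rightarrow> ereal).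
            real_or_infty \<psi> \<and> convex_fun \<psi> \<and> lsc_fun \<psi> \<and>
            (\<forall>\<nu> \<epsilon>. (\<forall>i. \<epsilon> $ i \<in> {-1, 1}) \<and> (\<Prod>i\<in>UNIV. \<epsilon> $ i) = 1 \<longrightarrow>
               \<psi> (e3 \<nu>) = \<psi> (e3 (diag \<epsilon> *v \<nu>))) \<and>
            (\<forall>\<alpha>. \<alpha> $ 3 \<le> 0 \<longrightarrow> \<psi> \<alpha> = \<infinity>) \<and>
            (\<forall>F. W F = (if det F > 0 then \<psi> (inv3 (right_stretch F)) else \<infinity>))
          \<longrightarrow> isotropic W \<and> lsc_polyconvex3 W)"
proof (rule conjI; intro allI impI; elim conjE)
  fix \<psi> :: "real^2 \<Rightarrow> ereal" and W :: "real^2^2 \<Rightarrow> ereal"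
  assume fin: "real_or_infty \<psi>" and conv: "convex_fun \<psi>" and lsc: "lsc_fun \<psi>"
    and sgn: "\<forall>\<nu> \<epsilon>. (\<forall>i. \<epsilon> $ i \<in> {-1, 1}) \<and> (\<Prod>i\<in>UNIV. \<epsilon> $ i) = 1 \<longrightarrow>
      \<psi> (e2 \<nu>) = \<psi> (e2 (diag \<epsilon> *v \<nu>))"
    and inf: "\<forall>\<alpha>. \<alpha> $ 2 \<le> 0 \<longrightarrow> \<psi> \<alpha> = \<infinity>"
    and W: "\<forall>F. W F = (if det F > 0 then \<psi> (inv2 (right_stretch F)) else \<infinity>)"
  have "isotropic W"
    by (rule isotropic_stretch_invariant[where f = "\<lambda>U. \<psi> (inv2 U)", OF W[THEN spec]])
       (simp add: inv2_conjugate)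
  moreover have "lsc_polyconvex2 W"
    by (rule lsc_polyconvex2_stretch_invariants[OF fin conv lsc
          sgn[THEN spec, THEN spec, THEN mp, OF conjI] inf[THEN spec, THEN mp] W[THEN spec]])
  ultimately show "isotropic W \<and> lsc_polyconvex2 W" ..
next
  fix \<psi> :: "real^3 \<Rightarrow> ereal" and W :: "real^3^3 \<Rightarrow> ereal"
  assume fin: "real_or_infty \<psi>" and conv: "convex_fun \<psi>" and lsc: "lsc_fun \<psi>"
    and sgn: "\<forall>\<nu> \<epsilon>. (\<forall>i. \<epsilon> $ i \<in> {-1, 1}) \<and> (\<Prod>i\<in>UNIV. \<epsilon> $ i) = 1 \<longrightarrow>
      \<psi> (e3 \<nu>) = \<psi> (e3 (diag \<epsilon> *v \<nu>))"
    and inf: "\<forall>\<alpha>. \<alpha> $ 3 \<le> 0 \<longrightarrow> \<psi> \<alpha> = \<infinity>"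
    and W: "\<forall>F. W F = (if det F > 0 then \<psi> (inv3 (right_stretch F)) else \<infinity>)"
  have "isotropic W"
    by (rule isotropic_stretch_invariant[where f = "\<lambda>U. \<psi> (inv3 U)", OF W[THEN spec]])
       (simp add: inv3_conjugate)
  moreover have "lsc_polyconvex3 W"
    by (rule lsc_polyconvex3_stretch_invariants[OF fin conv lsc
          sgn[THEN spec, THEN spec, THEN mp, OF conjI] inf[THEN spec, THEN mp] W[THEN spec]])
  ultimately show "isotropic W \<and> lsc_polyconvex3 W" ..
qed

end
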